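(* Let $\mathbf w\in\Delta_n$ be a generic weight vector, and consider the vertical segment $\{(q:\mathbf w): q\in(0,1]\}\subseteq\mathcal C_n$. As $q$ increases, the sequence of (weighted) games realized by $(q:\mathbf w)$ forms a saturated chain in $\mathcal W_n$. Moreover this chain (1) is maximal: it begins with the game $\langle 1\rangle$ (in which every nonempty coalition wins; the unique game of minimal rank $1$) and ends with the game $\langle N\rangle$ (in which only $N$ wins; the unique game of maximal rank $2^n-1$); and (2) is self-dual: if a game $v$ occurs in the chain, so does its dual $v^*$.
   Context: Let $N=\{1,\dots,n\}$. A simple game is a family $W$ of subsets of $N$ (winning coalitions) with $N\in W$, $\emptyset\notin W$, closed under supersets; its rank is its number of losing coalitions. The dual $v^*$ has winning coalitions those $A$ with $N\setminus A$ losing in $v$. Let $\Delta_n=\{\mathbf w=(w_n,\dots,w_1): w_n\ge\dots\ge w_1\ge0,\ \sum_i w_i=1\}$ and $\mathcal C_n=(0,1]\times\Delta_n$; for $(q:\mathbf w)\in\mathcal C_n$ the weighted game realized is the one whose winning coalitions are the $A$ with $w_A:=\sum_{i\in A}w_i\ge q$. A weighted game is one realized by some point of $\mathcal C_n$. $\mathcal W_n$ is the poset of weighted games on $n$ voters whose order is the reflexive-transitive closure of the covering relation: $u$ covers $v$ iff both are weighted and $W_v=W_u\cup\{A\}$ for a single coalition $A\notin W_u$. A weight vector $\mathbf w$ is generic if the sums $w_A$ are pairwise distinct for distinct coalitions $A$. *)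

theory Defs
  imports Complex_Main
begin

text \<open>The voters are \<open>{1..n}\<close>; a game is identified with its family of winning coalitions.\<close>

definition simple_game :: "nat \<Rightarrow> nat set set \<Rightarrow> bool" where
  "simple_game n W \<longleftrightarrow>
     W \<subseteq> Pow {1..n} \<and> {1..n} \<in> W \<and> {} \<notin> W \<and>
     (\<forall>A B. A \<in> W \<and> A \<subseteq> B \<and> B \<subseteq> {1..n} \<longrightarrow> B \<in> W)"

definition game_rank :: "nat \<Rightarrow> nat set set \<Rightarrow> nat" where
  "game_rank n W = card (Pow {1..n} - W)"

definition dual_game :: "nat \<Rightarrow> nat set set \<Rightarrow> nat set set" where
  "dual_game n W = {A. A \<subseteq> {1..n} \<and> {1..n} - A \<notin> W}"

text \<open>A weight vector \<open>(w_n, ..., w_1)\<close> is a function on \<open>nat\<close>, of which only the values on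
  \<open>{1..n}\<close> matter; voter \<open>n\<close> is the heaviest.\<close>

definition weight_simplex :: "nat \<Rightarrow> (nat \<Rightarrow> real) set" where
  "weight_simplex n =
     {w. mono_on {1..n} w \<and> (\<forall>i\<in>{1..n}. 0 \<le> w i) \<and> (\<Sum>i\<in>{1..n}. w i) = 1}"

definition configuration_space :: "nat \<Rightarrow> (real \<times> (nat \<Rightarrow> real)) set" where
  "configuration_space n = {0<..1} \<times> weight_simplex n"

definition realized_game :: "nat \<Rightarrow> real \<times> (nat \<Rightarrow> real) \<Rightarrow> nat set set" where
  "realized_game n = (\<lambda>(q, w). {A. A \<subseteq> {1..n} \<and> q \<le> sum w A})"

definition weighted_games :: "nat \<Rightarrow> nat set set set" where
  "weighted_games n = realized_game n ` configuration_space n"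

text \<open>\<open>covers n u v\<close> says that \<open>u\<close> covers \<open>v\<close>. The upper game \<open>u\<close> has the fewer winning
  coalitions, hence the larger rank.\<close>

definition covers :: "nat \<Rightarrow> nat set set \<Rightarrow> nat set set \<Rightarrow> bool" where
  "covers n u v \<longleftrightarrow>
     u \<in> weighted_games n \<and> v \<in> weighted_games n \<and> (\<exists>A. A \<notin> u \<and> v = u \<union> {A})"

definition game_le :: "nat \<Rightarrow> nat set set \<Rightarrow> nat set set \<Rightarrow> bool" where
  "game_le n v u \<longleftrightarrow>
     v \<in> weighted_games n \<and> u \<in> weighted_games n \<and> (\<lambda>x y. covers n y x)\<^sup>*\<^sup>* v u"

text \<open>A saturated chain is listed from the bottom up.\<close>

definition saturated_chain :: "nat \<Rightarrow> nat set set list \<Rightarrow> bool" where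
  "saturated_chain n vs \<longleftrightarrow>
     vs \<noteq> [] \<and> set vs \<subseteq> weighted_games n \<and> successively (\<lambda>v u. covers n u v) vs"

definition generic :: "nat \<Rightarrow> (nat \<Rightarrow> real) \<Rightarrow> bool" where
  "generic n w \<longleftrightarrow> inj_on (sum w) (Pow {1..n})"

text \<open>\<open>vs\<close> lists the games realized by \<open>(q, w)\<close> in the order in which they occur as \<open>q\<close> runs
  upwards through \<open>{0<..1}\<close>, with a new entry exactly when the game changes: \<open>k q\<close> is the position
  in the list of the game at quota \<open>q\<close>. These conditions determine \<open>vs\<close> uniquely.\<close>

definition segment_sequence :: "nat \<Rightarrow> (nat \<Rightarrow> real) \<Rightarrow> nat set set list \<Rightarrow> bool" where
  "segment_sequence n w vs \<longleftrightarrow>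
     distinct_adj vs \<and>
     (\<exists>k :: real \<Rightarrow> nat. mono_on {0<..1} k \<and> k ` {0<..1} = {..<length vs} \<and>
        (\<forall>q\<in>{0<..1}. realized_game n (q, w) = vs ! k q))"

text \<open>The games \<open>\<langle>1\<rangle>\<close> and \<open>\<langle>N\<rangle>\<close>.\<close>

definition bottom_game :: "nat \<Rightarrow> nat set set" where
  "bottom_game n = {A. A \<subseteq> {1..n} \<and> A \<noteq> {}}"

definition top_game :: "nat \<Rightarrow> nat set set" where
  "top_game n = {{1..n}}"

end

theory Submission
  imports Defs
begin

text \<open>Games realized with one fixed weight vector are nested, so each is determined by its rank.
  The rank of the game at quota \<open>q\<close> counts the coalition weights below \<open>q\<close>; as generic weights give
  \<open>2^n\<close> distinct coalition weights, every rank from \<open>1\<close> to \<open>2^n - 1\<close> occurs, one after the other.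
  Comparable games of equal rank coincide, so a chain meeting every rank is maximal. The dual of the
  game at quota \<open>q\<close> is the game just above quota \<open>1 - q\<close>.\<close>

text \<open>The witness is entry \<open>m\<close> of the increasing enumeration of \<open>S\<close>:
  positions count from 0, so exactly \<open>m\<close> entries precede it. With \<open>S\<close> the
  set of coalition weights it supplies the quotas.\<close>

lemma finite_linorder_rank_exists:
  fixes S :: "'a::linorder set"
  assumes "finite S" and "m < card S"
  shows "\<exists>x\<in>S. card {y \<in> S. y < x} = m"
proof -
  define xs where "xs = sorted_list_of_set S"
  have xs: "sorted_wrt (<) xs" "set xs = S" "length xs = card S"
    using assms(1) by (auto simp: xs_def)
  have less_iff: "xs ! i < xs ! j \<longleftrightarrow> i < j" if "i < length xs" "j < length xs" for i j
    using xs(1) that by (metis linorder_neqE_nat order_less_asym sorted_wrt_nth_less)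
  have m: "m < length xs"
    using assms(2) xs(3) by simp
  have "{y \<in> S. y < xs ! m} = (!) xs ` {..<m}"
  proof (intro equalityI subsetI)
    fix y
    assume y: "y \<in> {y \<in> S. y < xs ! m}"
    then obtain i where i: "i < length xs" "y = xs ! i"
      using xs(2) by (metis (lifting) in_set_conv_nth mem_Collect_eq)
    then show "y \<in> (!) xs ` {..<m}"
      using y less_iff[OF i(1) m] by auto
  next
    fix y
    assume "y \<in> (!) xs ` {..<m}"
    then obtain i where i: "i < m" "y = xs ! i"
      by auto
    then show "y \<in> {y \<in> S. y < xs ! m}"
      using m less_iff[of i m] xs(2) nth_mem[of i xs] by auto
  qed
  moreover have "inj_on ((!) xs) {..<m}"
    using m less_iff
    by (intro inj_onI) (metis lessThan_iff linorder_neqE_nat order.strict_trans order_less_irrefl)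
  ultimately have "card {y \<in> S. y < xs ! m} = m"
    by (simp add: card_image)
  then show ?thesis
    using m xs(2) by (metis nth_mem)
qed

section \<open>Ranks of simple games and the two extremal games\<close>

lemma game_rank_eq:
  assumes "W \<subseteq> Pow {1..n}"
  shows "card W + game_rank n W = 2 ^ n"
proof -
  have "card (Pow {1..n}) = 2 ^ n"
    by (simp add: card_Pow)
  then show ?thesis
    using assms card_mono[OF _ assms]
    by (simp add: game_rank_def card_Diff_subset finite_subset)
qed

text \<open>Winning and losing coalitions number \<open>2 ^ n\<close> together, so equal ranks give
  equal cardinalities, and a finite set has no proper subset of its own cardinality.\<close>

lemma game_eq_if_rank_eq:
  assumes "u \<subseteq> v" "v \<subseteq> Pow {1..n}" "game_rank n u = game_rank n v"
  shows "u = v"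
proof -
  have "card u = card v"
    using assms game_rank_eq[OF order_trans[OF assms(1,2)]] game_rank_eq[OF assms(2)] by linarith
  then show ?thesis
    using assms by (metis card_subset_eq finite_Pow_iff finite_atLeastAtMost finite_subset)
qed

lemma simple_game_rank_bounds:
  assumes "simple_game n v"
  shows "1 \<le> game_rank n v" and "game_rank n v \<le> 2 ^ n - 1"
proof -
  have v: "v \<subseteq> Pow {1..n}" "{1..n} \<in> v" "{} \<notin> v"
    using assms by (auto simp: simple_game_def)
  have "Pow {1..n} - v \<noteq> {}"
    using v by auto
  then show "1 \<le> game_rank n v"
    by (simp add: game_rank_def Suc_le_eq card_gt_0_iff)
  have "finite v"
    using v(1) by (rule finite_subset) simp
  then have "0 < card v"
    using v(2) by (auto simp: card_gt_0_iff)
  then show "game_rank n v \<le> 2 ^ n - 1"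
    using game_rank_eq[OF v(1)] by linarith
qed

lemma simple_game_extremal:
  assumes "1 \<le> n"
  shows "simple_game n (bottom_game n)" and "simple_game n (top_game n)"
  using assms by (auto simp: simple_game_def bottom_game_def top_game_def)

lemma game_rank_bottom: "game_rank n (bottom_game n) = 1"
proof -
  have "Pow {1..n} - bottom_game n = {{}}"
    by (auto simp: bottom_game_def)
  then show ?thesis
    by (simp add: game_rank_def)
qed

lemma game_rank_top: "game_rank n (top_game n) = 2 ^ n - 1"
  using game_rank_eq[of "top_game n" n] by (simp add: top_game_def)

text \<open>The empty coalition loses in every simple game, so \<open>bottom_game n\<close> contains
  them all, and equal rank turns the inclusion into equality.\<close>

lemma simple_game_rank_eq_1_iff:
  assumes "1 \<le> n"
  shows "simple_game n v \<and> game_rank n v = 1 \<longleftrightarrow> v = bottom_game n"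
proof
  assume v: "simple_game n v \<and> game_rank n v = 1"
  then have "v \<subseteq> bottom_game n"
    by (auto simp: simple_game_def bottom_game_def)
  then show "v = bottom_game n"
    by (rule game_eq_if_rank_eq) (use v game_rank_bottom in \<open>auto simp: bottom_game_def\<close>)
qed (use assms simple_game_extremal game_rank_bottom in auto)

lemma simple_game_rank_eq_max_iff:
  assumes "1 \<le> n"
  shows "simple_game n v \<and> game_rank n v = 2 ^ n - 1 \<longleftrightarrow> v = top_game n"
proof
  assume v: "simple_game n v \<and> game_rank n v = 2 ^ n - 1"
  then have "top_game n \<subseteq> v"
    by (auto simp: simple_game_def top_game_def)
  then have "top_game n = v"
    by (rule game_eq_if_rank_eq) (use v game_rank_top in \<open>auto simp: simple_game_def\<close>)
  then show "v = top_game n" ..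
qed (use assms simple_game_extremal game_rank_top in auto)

section \<open>Games realized with a fixed weight vector\<close>

lemma weight_simplex_pos: "w \<in> weight_simplex n \<Longrightarrow> 1 \<le> n"
  \<comment> \<open>For \<open>n = 0\<close> the total weight is an empty sum, which is 0 and not
    1.\<close>
  by (cases n) (auto simp: weight_simplex_def)

lemma coalition_weight_mono:
  assumes "w \<in> weight_simplex n" "A \<subseteq> B" "B \<subseteq> {1..n}"
  shows "sum w A \<le> sum w B"
  using assms by (intro sum_mono2) (auto simp: weight_simplex_def intro: finite_subset)

lemma coalition_weight_bounds:
  assumes "w \<in> weight_simplex n" "A \<subseteq> {1..n}"
  shows "0 \<le> sum w A" and "sum w A \<le> 1"
  using coalition_weight_mono[OF assms(1), of "{}" A] coalition_weight_mono[OF assms(1), of A "{1..n}"]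
    assms by (auto simp: weight_simplex_def)

lemma realized_game_subset: "realized_game n (q, w) \<subseteq> Pow {1..n}"
  by (auto simp: realized_game_def)

lemma realized_game_antimono: "q \<le> q' \<Longrightarrow> realized_game n (q', w) \<subseteq> realized_game n (q, w)"
  by (auto simp: realized_game_def)

lemma simple_game_realized:
  assumes "w \<in> weight_simplex n" "q \<in> {0<..1}"
  shows "simple_game n (realized_game n (q, w))"
  unfolding simple_game_def
proof (intro conjI allI impI)
  show "{1..n} \<in> realized_game n (q, w)" "{} \<notin> realized_game n (q, w)"
    using assms by (auto simp: realized_game_def weight_simplex_def)
  fix A B
  assume "A \<in> realized_game n (q, w) \<and> A \<subseteq> B \<and> B \<subseteq> {1..n}"
  then show "B \<in> realized_game n (q, w)"
    using coalition_weight_mono[OF assms(1), of A B] by (auto simp: realized_game_def)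
qed (rule realized_game_subset)

lemma weighted_games_simple: "u \<in> weighted_games n \<Longrightarrow> simple_game n u"
  using simple_game_realized by (auto simp: weighted_games_def configuration_space_def)

lemma realized_game_weighted:
  "w \<in> weight_simplex n \<Longrightarrow> q \<in> {0<..1} \<Longrightarrow> realized_game n (q, w) \<in> weighted_games n"
  by (auto simp: weighted_games_def configuration_space_def)

lemma realized_game_rank_mono:
  "q \<le> q' \<Longrightarrow> game_rank n (realized_game n (q, w)) \<le> game_rank n (realized_game n (q', w))"
  unfolding game_rank_def using realized_game_antimono[of q q' n w] by (intro card_mono) auto

lemma realized_game_eq_if_rank_eq:
  assumes "game_rank n (realized_game n (q, w)) = game_rank n (realized_game n (q', w))"
  shows "realized_game n (q, w) = realized_game n (q', w)"
  using assms game_eq_if_rank_eq realized_game_antimono realized_game_subset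
  by (metis linorder_le_cases)

text \<open>The quota is the coalition weight with exactly \<open>r\<close> coalition weights below
  it. By genericity these belong to \<open>r\<close> different coalitions, namely the losing
  ones.\<close>

lemma quota_of_rank_exists:
  assumes w: "w \<in> weight_simplex n" and "generic n w" and r: "r \<in> {1..<2 ^ n}"
  shows "\<exists>q\<in>{0<..1}. game_rank n (realized_game n (q, w)) = r"
proof -
  let ?S = "sum w ` Pow {1..n}"
  have inj: "inj_on (sum w) (Pow {1..n})"
    using assms(2) by (simp add: generic_def)
  have "card ?S = 2 ^ n"
    using inj by (simp add: card_image card_Pow)
  then obtain q where q: "q \<in> ?S" "card {y \<in> ?S. y < q} = r"
    using finite_linorder_rank_exists[of ?S r] r by auto
  have "{y \<in> ?S. y < q} = sum w ` (Pow {1..n} - realized_game n (q, w))"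
    by (auto simp: realized_game_def)
  then have rank: "game_rank n (realized_game n (q, w)) = r"
    using q(2) inj by (simp add: game_rank_def card_image inj_on_diff)
  \<comment> \<open>Here \<open>1 \<le> r\<close> enters: some nonnegative coalition weight lies
    below \<open>q\<close>, which makes \<open>q\<close> positive.\<close>
  have "{y \<in> ?S. y < q} \<noteq> {}"
    using q(2) r by (metis atLeastLessThan_iff card.empty not_one_le_zero)
  then obtain A where "A \<subseteq> {1..n}" "sum w A < q"
    by blast
  then have "0 < q"
    using coalition_weight_bounds(1)[OF w, of A] by linarith
  moreover have "q \<le> 1"
    using q(1) coalition_weight_bounds(2)[OF w] by blast
  ultimately have "q \<in> {0<..1}"
    by simp
  with rank show ?thesis by blast
qed

text \<open>A coalition wins in the dual iff its complement weighs less than \<open>q\<close>, that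
  is, iff it weighs more than \<open>1 - q\<close>. The least coalition weight above
  \<open>1 - q\<close> turns this strict bound into a quota.\<close>

lemma dual_realized_game:
  assumes w: "w \<in> weight_simplex n" and q: "q \<in> {0<..1}"
  shows "\<exists>q'\<in>{0<..1}. dual_game n (realized_game n (q, w)) = realized_game n (q', w)"
proof -
  define S where "S = {s \<in> sum w ` Pow {1..n}. 1 - q < s}"
  have total: "sum w {1..n} = 1"
    using w by (simp add: weight_simplex_def)
  have compl: "sum w ({1..n} - A) = 1 - sum w A" if "A \<subseteq> {1..n}" for A
    using total that by (simp add: sum_diff)
  have "finite S"
    by (simp add: S_def)
  \<comment> \<open>The grand coalition makes \<open>S\<close> nonempty and bounds its minimum by 1;
    positivity of the minimum comes from \<open>q \<le> 1\<close>.\<close>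
  have "1 \<in> S"
    using q total by (auto simp: S_def image_iff intro!: bexI[of _ "{1..n}"])
  have "Min S \<in> S"
    using \<open>finite S\<close> \<open>1 \<in> S\<close> by (intro Min_in) auto
  have "Min S \<in> {0<..1}"
    using \<open>Min S \<in> S\<close> Min_le[OF \<open>finite S\<close> \<open>1 \<in> S\<close>] q by (auto simp: S_def)
  moreover have "A \<in> dual_game n (realized_game n (q, w)) \<longleftrightarrow> A \<in> realized_game n (Min S, w)" for A
  proof (cases "A \<subseteq> {1..n}")
    case True
    have "Min S \<le> sum w A \<longleftrightarrow> 1 - q < sum w A"
    proof
      assume "1 - q < sum w A"
      with True have "sum w A \<in> S" by (auto simp: S_def)
      then show "Min S \<le> sum w A" using \<open>finite S\<close> by simp
    qed (use \<open>Min S \<in> S\<close> in \<open>auto simp: S_def\<close>)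
    then show ?thesis
      using True compl[OF True] by (auto simp: dual_game_def realized_game_def)
  qed (simp add: dual_game_def realized_game_def)
  ultimately show ?thesis by blast
qed

section \<open>Covering relation and chains of weighted games\<close>

lemma game_le_subset:
  assumes "game_le n v u"
  shows "u \<subseteq> v"
proof -
  have "(\<lambda>x y. covers n y x)\<^sup>*\<^sup>* v u"
    using assms by (simp add: game_le_def)
  then show ?thesis
    by induction (auto simp: covers_def)
qed

lemma covers_if_rank_Suc:
  assumes "u \<in> weighted_games n" "v \<in> weighted_games n"
    and "u \<subseteq> v" "game_rank n u = Suc (game_rank n v)"
  shows "covers n u v"
proof -
  have v: "v \<subseteq> Pow {1..n}" and "finite u"
    using weighted_games_simple[OF assms(2)] assms(3)
    by (auto simp: simple_game_def intro: finite_subset)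
  have "card (v - u) = 1"
    using game_rank_eq[OF v] game_rank_eq[OF order_trans[OF assms(3) v]] assms(3,4) \<open>finite u\<close>
    by (simp add: card_Diff_subset)
  then obtain A where "v - u = {A}"
    by (auto simp: card_1_singleton_iff)
  then show ?thesis
    using assms(1-3) by (auto simp: covers_def)
qed

lemma saturated_chain_comparable:
  assumes "saturated_chain n vs" "u \<in> set vs" "v \<in> set vs"
  shows "game_le n u v \<or> game_le n v u"
proof -
  let ?R = "\<lambda>x y. covers n y x"
  \<comment> \<open>Passing to the closure gives a transitive relation, so that the relation between
    neighbours extends to all pairs of positions.\<close>
  have "successively ?R\<^sup>*\<^sup>* vs"
    using assms(1) unfolding saturated_chain_def
    by (blast intro: successively_mono)
  then have "sorted_wrt ?R\<^sup>*\<^sup>* vs"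
    by (simp add: successively_conv_sorted_wrt)
  then have "?R\<^sup>*\<^sup>* u v \<or> ?R\<^sup>*\<^sup>* v u"
    using assms(2,3) by (metis in_set_conv_nth linorder_neqE_nat rtranclp.rtrancl_refl sorted_wrt_nth_less)
  then show ?thesis
    using assms by (auto simp: game_le_def saturated_chain_def)
qed

text \<open>A further game in a larger chain would share its rank with some entry of
  \<open>vs\<close>; being comparable, the two are nested and hence equal.\<close>

lemma maxchain_if_all_ranks:
  assumes chain: "saturated_chain n vs"
    and ranks: "\<And>r. r \<in> {1..<2 ^ n} \<Longrightarrow> \<exists>v\<in>set vs. game_rank n v = r"
  shows "pred_on.maxchain (weighted_games n) (game_le n) (set vs)"
  unfolding pred_on.maxchain_def
proof (intro conjI notI)
  show "pred_on.chain (weighted_games n) (game_le n) (set vs)"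
    using chain saturated_chain_comparable[OF chain]
    by (auto simp: pred_on.chain_def saturated_chain_def)
  assume "\<exists>C. pred_on.chain (weighted_games n) (game_le n) C \<and> set vs \<subset> C"
  then obtain C u where C: "pred_on.chain (weighted_games n) (game_le n) C" "set vs \<subseteq> C"
    and u: "u \<in> C" "u \<notin> set vs"
    by blast
  have weighted: "C \<subseteq> weighted_games n"
    using C(1) by (simp add: pred_on.chain_def)
  have "game_rank n u \<in> {1..<2 ^ n}"
    using simple_game_rank_bounds[of n u] weighted_games_simple weighted u(1)
    by (auto simp: less_eq_Suc_le)
  then obtain v where v: "v \<in> set vs" "game_rank n v = game_rank n u"
    using ranks by blast
  \<comment> \<open>The first disjunct comes from the reflexive closure in
    \<open>pred_on.chain\<close>.\<close>
  have "u = v \<or> game_le n u v \<or> game_le n v u"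
    using C u(1) v(1) by (auto simp: pred_on.chain_def)
  then have "u \<subseteq> v \<or> v \<subseteq> u"
    using game_le_subset by blast
  moreover have "u \<subseteq> Pow {1..n}" "v \<subseteq> Pow {1..n}"
    using weighted_games_simple weighted u(1) v(1) C(2) by (force simp: simple_game_def)+
  ultimately have "u = v"
    using game_eq_if_rank_eq v(2) by metis
  with u(2) v(1) show False by simp
qed

theorem theorem4p12:
  fixes n :: nat and w :: "nat \<Rightarrow> real"
  assumes "w \<in> weight_simplex n" and "generic n w"
  shows "(\<exists>vs. segment_sequence n w vs \<and>
            saturated_chain n vs \<and>
            pred_on.maxchain (weighted_games n) (game_le n) (set vs) \<and>
            hd vs = bottom_game n \<and> last vs = top_game n \<and>
            (\<forall>v \<in> set vs. dual_game n v \<in> set vs)) \<and>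
         (\<forall>v. simple_game n v \<longrightarrow> 1 \<le> game_rank n v \<and> game_rank n v \<le> 2 ^ n - 1) \<and>
         (\<forall>v. simple_game n v \<and> game_rank n v = 1 \<longleftrightarrow> v = bottom_game n) \<and>
         (\<forall>v. simple_game n v \<and> game_rank n v = 2 ^ n - 1 \<longleftrightarrow> v = top_game n)"
proof -
  have n: "1 \<le> n"
    using assms(1) by (rule weight_simplex_pos)
  have two: "2 \<le> (2::nat) ^ n"
    using n self_le_power[of 2 n] by simp
  let ?G = "\<lambda>q. realized_game n (q, w)"
  obtain quota where quota: "\<And>r. r \<in> {1..<2 ^ n} \<Longrightarrow> quota r \<in> {0<..1}"
    "\<And>r. r \<in> {1..<2 ^ n} \<Longrightarrow> game_rank n (?G (quota r)) = r"
    using quota_of_rank_exists[OF assms] by metis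
  \<comment> \<open>One game for each rank, in increasing order; ranks start at 1 and positions at
    0, so entry \<open>i\<close> has rank \<open>Suc i\<close>.\<close>
  define vs where "vs = map (\<lambda>r. ?G (quota r)) [1..<2 ^ n]"
  have len: "length vs = 2 ^ n - 1"
    by (simp add: vs_def)
  have nth: "vs ! i = ?G (quota (Suc i))" if "i < length vs" for i
    using that by (simp add: vs_def)
  have rank_nth: "game_rank n (vs ! i) = Suc i" if "i < length vs" for i
    using that quota(2)[of "Suc i"] by (simp add: nth len)
  have simple: "simple_game n (?G q)" if "q \<in> {0<..1}" for q
    using assms(1) that by (rule simple_game_realized)
  have "vs \<noteq> []"
    using len two by auto
  \<comment> \<open>The natural subtraction is exact because every simple game has rank at least
    1.\<close>
  define k where "k q = game_rank n (?G q) - 1" for q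
  have Suc_k: "Suc (k q) = game_rank n (?G q)" "k q < length vs" if "q \<in> {0<..1}" for q
    using simple_game_rank_bounds[OF simple[OF that]] two by (auto simp: k_def len)
  have G_nth: "?G q = vs ! k q" if "q \<in> {0<..1}" for q
    using Suc_k[OF that] rank_nth[of "k q"] nth[of "k q"]
    by (metis realized_game_eq_if_rank_eq)
  \<comment> \<open>The chosen quotas thus lose no game of the segment, which reduces self-duality
    to \<open>dual_realized_game\<close>.\<close>
  have set_vs: "set vs = ?G ` {0<..1}"
  proof
    show "set vs \<subseteq> ?G ` {0<..1}"
      using quota(1) by (auto simp: vs_def)
    show "?G ` {0<..1} \<subseteq> set vs"
      using G_nth Suc_k(2) by (metis image_subsetI nth_mem)
  qed
  have weighted: "set vs \<subseteq> weighted_games n"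
    using realized_game_weighted[OF assms(1)] by (auto simp: set_vs)

  have "segment_sequence n w vs"
    unfolding segment_sequence_def
  proof (intro conjI exI[of _ k] ballI)
    show "distinct_adj vs"
      unfolding distinct_adj_conv_nth
    proof (intro allI impI notI)
      fix i
      assume "Suc i < length vs" "vs ! i = vs ! Suc i"
      then show False
        using rank_nth[of i] rank_nth[of "Suc i"] by simp
    qed
    show "mono_on {0<..1} k"
      by (auto simp: k_def intro!: mono_onI diff_le_mono realized_game_rank_mono)
    show "k ` {0<..1} = {..<length vs}"
    proof
      show "{..<length vs} \<subseteq> k ` {0<..1}"
      proof
        fix i
        assume "i \<in> {..<length vs}"
        then show "i \<in> k ` {0<..1}"
          using quota[of "Suc i"] len by (intro image_eqI[of _ _ "quota (Suc i)"]) (auto simp: k_def)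
      qed
    qed (use Suc_k in auto)
  qed (rule G_nth)
  moreover have chain: "saturated_chain n vs"
    unfolding saturated_chain_def successively_conv_nth
  proof (intro conjI allI impI)
    fix i
    assume i: "Suc i < length vs"
    \<comment> \<open>The chosen quotas increase with the rank, since rank is monotone in the quota;
      this makes neighbouring entries nested.\<close>
    have "\<not> quota (Suc (Suc i)) \<le> quota (Suc i)"
      using realized_game_rank_mono[of "quota (Suc (Suc i))" "quota (Suc i)" n w]
        rank_nth[of i] rank_nth[of "Suc i"] nth i by auto
    then have "vs ! Suc i \<subseteq> vs ! i"
      using i realized_game_antimono by (simp add: nth)
    then show "covers n (vs ! Suc i) (vs ! i)"
      using i weighted rank_nth by (intro covers_if_rank_Suc) auto
  qed (use \<open>vs \<noteq> []\<close> weighted in auto)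
  moreover have "pred_on.maxchain (weighted_games n) (game_le n) (set vs)"
    using quota set_vs by (intro maxchain_if_all_ranks[OF chain]) blast
  moreover have "hd vs = bottom_game n"
  proof -
    have "simple_game n (hd vs)"
      using weighted weighted_games_simple hd_in_set[OF \<open>vs \<noteq> []\<close>] by blast
    moreover have "game_rank n (hd vs) = 1"
      using rank_nth[of 0] \<open>vs \<noteq> []\<close> by (simp add: hd_conv_nth)
    ultimately show ?thesis
      using simple_game_rank_eq_1_iff[OF n] by blast
  qed
  moreover have "last vs = top_game n"
  proof -
    have "simple_game n (last vs)"
      using weighted weighted_games_simple last_in_set[OF \<open>vs \<noteq> []\<close>] by blast
    moreover have "game_rank n (last vs) = 2 ^ n - 1"
      using rank_nth[of "length vs - 1"] \<open>vs \<noteq> []\<close> len two by (simp add: last_conv_nth)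
    ultimately show ?thesis
      using simple_game_rank_eq_max_iff[OF n] by blast
  qed
  moreover have "\<forall>v\<in>set vs. dual_game n v \<in> set vs"
    using dual_realized_game[OF assms(1)] by (auto simp: set_vs image_iff)
  ultimately show ?thesis
    using simple_game_rank_bounds simple_game_rank_eq_1_iff[OF n] simple_game_rank_eq_max_iff[OF n]
    by blast
qed

end
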